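(* Let $M:\mathbb{R}^d\rightrightarrows\mathbb{R}^d$ be a set-valued operator with $X_*(M)\neq\emptyset$ that is maximal $\gamma$-weakly monotone for some $\gamma\ge 0$ and satisfies the strong MVI condition with some $\mu\ge 0$. Let $h$ be a Legendre function that is $\mu_h$-strongly convex and $L_h$-smooth with $\mu_h>\gamma$. Then, for every $k\ge1$ and every $x_*\in S_*^\mu(M)$, the sequence $\{x_k\}$ of the Bregman proximal point method $x_{k+1}=R(x_k)$, $k=0,1,\dots$, satisfies $$D_h(x_*,x_k)\le\left(\frac{2\mu}{L_h}+1\right)^{-k}D_h(x_*,x_0).$$
   Context: $\mathbb{R}^d$ carries the Euclidean inner product and norm. For a set-valued operator $M$, $\operatorname{gra}M=\{(x,w):w\in Mx\}$ and $X_*(M)=\{x_*: 0\in Mx_*\}$ (assumed nonempty). $M$ is $\gamma$-weakly monotone if $\langle x-y,w-z\rangle\ge-\gamma\|x-y\|^2$ for all $(x,w),(y,z)\in\operatorname{gra}M$; it is maximal if no $\gamma$-weakly monotone operator has a graph properly containing $\operatorname{gra}M$. Strong MVI condition with $\mu\ge0$: there exists $x_*\in X_*(M)$ such that $\langle x-x_*,w\rangle\ge\mu\|x-x_*\|^2$ for all $(x,w)\in\operatorname{gra}M$. $S_*^\mu(M)$ denotes the set of all $x_*\in X_*(M)$ with this property. A Legendre function $h:\mathbb{R}^d\to(-\infty,\infty]$ is a closed, proper, strictly convex function that is essentially smooth: $\operatorname{int}\operatorname{dom}h\neq\emptyset$, $h$ is differentiable on $\operatorname{int}\operatorname{dom}h$,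 and $\|\nabla h(x_k)\|\to\infty$ whenever $\{x_k\}\subset\operatorname{int}\operatorname{dom}h$ converges to a boundary point of $\operatorname{int}\operatorname{dom}h$. $h$ is $L_h$-smooth if $\nabla h$ is $L_h$-Lipschitz continuous; $h$ is $\mu_h$-strongly convex if $h-\frac{\mu_h}{2}\|\cdot\|^2$ is convex. The Bregman distance is $D_h(x,y)=h(x)-h(y)-\langle\nabla h(y),x-y\rangle$ for $x\in\operatorname{dom}h$, $y\in\operatorname{int}\operatorname{dom}h$. The $h$-resolvent of $M$ is $R=(\nabla h+M)^{-1}\nabla h$, i.e. $y\in R(x)$ iff $\nabla h(x)-\nabla h(y)\in My$; under the hypotheses it is single-valued. The initial point $x_0$ is arbitrary in $\operatorname{int}\operatorname{dom}h$. *)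

theory Defs
  imports "HOL-Analysis.Analysis"
begin

definition gra :: "('a \<Rightarrow> 'a set) \<Rightarrow> ('a \<times> 'a) set" where
  "gra M = {(x, w). w \<in> M x}"

definition zeros :: "('a::real_inner \<Rightarrow> 'a set) \<Rightarrow> 'a set" where
  "zeros M = {x. 0 \<in> M x}"

definition weakly_monotone :: "real \<Rightarrow> ('a::real_inner \<Rightarrow> 'a set) \<Rightarrow> bool" where
  "weakly_monotone \<gamma> M \<longleftrightarrow>
     (\<forall>(x, w) \<in> gra M. \<forall>(y, z) \<in> gra M.
        (x - y) \<bullet> (w - z) \<ge> - \<gamma> * (norm (x - y))\<^sup>2)"

definition maximal_weakly_monotone :: "real \<Rightarrow> ('a::real_inner \<Rightarrow> 'a set) \<Rightarrow> bool" where
  "maximal_weakly_monotone \<gamma> M \<longleftrightarrow>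
     weakly_monotone \<gamma> M \<and> \<not> (\<exists>N. weakly_monotone \<gamma> N \<and> gra M \<subset> gra N)"

definition strong_MVI_solutions :: "real \<Rightarrow> ('a::real_inner \<Rightarrow> 'a set) \<Rightarrow> 'a set" where
  "strong_MVI_solutions \<mu> M =
     {xs \<in> zeros M. \<forall>(x, w) \<in> gra M. (x - xs) \<bullet> w \<ge> \<mu> * (norm (x - xs))\<^sup>2}"

definition strong_MVI :: "real \<Rightarrow> ('a::real_inner \<Rightarrow> 'a set) \<Rightarrow> bool" where
  "strong_MVI \<mu> M \<longleftrightarrow>
     (\<exists>xs \<in> zeros M. \<forall>(x, w) \<in> gra M. (x - xs) \<bullet> w \<ge> \<mu> * (norm (x - xs))\<^sup>2)"

text \<open>Extended-real-valued functions; values in \<open>(-\<infinity>, \<infinity>]\<close> are enforced by \<open>proper_fun\<close>.\<close>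

definition edom :: "('a \<Rightarrow> ereal) \<Rightarrow> 'a set" where
  "edom h = {x. h x < \<infinity>}"

definition eepigraph :: "('a \<Rightarrow> ereal) \<Rightarrow> ('a \<times> real) set" where
  "eepigraph h = {(x, r). h x \<le> ereal r}"

definition proper_fun :: "('a \<Rightarrow> ereal) \<Rightarrow> bool" where
  "proper_fun h \<longleftrightarrow> (\<forall>x. h x \<noteq> -\<infinity>) \<and> edom h \<noteq> {}"

definition closed_fun :: "('a::real_normed_vector \<Rightarrow> ereal) \<Rightarrow> bool" where
  "closed_fun h \<longleftrightarrow> closed (eepigraph h)"

definition convex_fun :: "('a::real_normed_vector \<Rightarrow> ereal) \<Rightarrow> bool" where
  "convex_fun h \<longleftrightarrow> convex (eepigraph h)"

definition strictly_convex_fun :: "('a::real_normed_vector \<Rightarrow> ereal) \<Rightarrow> bool" where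
  "strictly_convex_fun h \<longleftrightarrow>
     (\<forall>x \<in> edom h. \<forall>y \<in> edom h. \<forall>t::real. x \<noteq> y \<longrightarrow> 0 < t \<longrightarrow> t < 1 \<longrightarrow>
        h ((1 - t) *\<^sub>R x + t *\<^sub>R y) < ereal (1 - t) * h x + ereal t * h y)"

definition strongly_convex_fun :: "real \<Rightarrow> ('a::real_normed_vector \<Rightarrow> ereal) \<Rightarrow> bool" where
  "strongly_convex_fun \<mu> h \<longleftrightarrow> convex_fun (\<lambda>x. h x - ereal (\<mu> / 2 * (norm x)\<^sup>2))"

text \<open>The gradient is only meaningful at points of \<open>interior (edom h)\<close>; near such a point a
  proper \<open>h\<close> is finite, so passing to \<open>real_of_ereal\<close> does not change it.\<close>

definition gradient :: "('a::real_inner \<Rightarrow> ereal) \<Rightarrow> 'a \<Rightarrow> 'a" where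
  "gradient h x = (THE g. GDERIV (\<lambda>y. real_of_ereal (h y)) x :> g)"

definition essentially_smooth :: "('a::real_inner \<Rightarrow> ereal) \<Rightarrow> bool" where
  "essentially_smooth h \<longleftrightarrow>
     interior (edom h) \<noteq> {} \<and>
     (\<forall>x \<in> interior (edom h). (\<lambda>y. real_of_ereal (h y)) differentiable (at x)) \<and>
     (\<forall>X p. range X \<subseteq> interior (edom h) \<longrightarrow> p \<in> frontier (interior (edom h)) \<longrightarrow>
        X \<longlonglongrightarrow> p \<longrightarrow> filterlim (\<lambda>k. norm (gradient h (X k))) at_top sequentially)"

definition Legendre_fun :: "('a::real_inner \<Rightarrow> ereal) \<Rightarrow> bool" where
  "Legendre_fun h \<longleftrightarrow>
     closed_fun h \<and> proper_fun h \<and> strictly_convex_fun h \<and> essentially_smooth h"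

definition smooth_fun :: "real \<Rightarrow> ('a::real_inner \<Rightarrow> ereal) \<Rightarrow> bool" where
  "smooth_fun L h \<longleftrightarrow> L-lipschitz_on (interior (edom h)) (gradient h)"

text \<open>Intended for \<open>x \<in> edom h\<close> and \<open>y \<in> interior (edom h)\<close>; for \<open>x \<notin> edom h\<close> the value is \<open>\<infinity>\<close>.\<close>

definition bregman :: "('a::real_inner \<Rightarrow> ereal) \<Rightarrow> 'a \<Rightarrow> 'a \<Rightarrow> ereal" where
  "bregman h x y = h x - h y - ereal (gradient h y \<bullet> (x - y))"

text \<open>The domain of the gradient is \<open>interior (edom h)\<close>, so the composition
  \<open>(\<nabla>h + M)\<inverse> \<circ> \<nabla>h\<close> relates points of \<open>interior (edom h)\<close> only.\<close>

definition resolvent ::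
  "('a::real_inner \<Rightarrow> ereal) \<Rightarrow> ('a \<Rightarrow> 'a set) \<Rightarrow> 'a \<Rightarrow> 'a set" where
  "resolvent h M x =
     {y. x \<in> interior (edom h) \<and> y \<in> interior (edom h) \<and> gradient h x - gradient h y \<in> M y}"

end

theory Submission
  imports Defs
begin

text \<open>
  Write \<open>D = D\<^sub>h\<close>. The resolvent inclusion says that \<open>w = \<nabla>h(x\<^sub>n) - \<nabla>h(x\<^sub>n\<^sub>+\<^sub>1)\<close> belongs to
  \<open>M x\<^sub>n\<^sub>+\<^sub>1\<close>. The three-point identity turns the pairing of \<open>w\<close> with \<open>x\<^sub>n\<^sub>+\<^sub>1 - x\<^sub>*\<close> into
  \<open>D(x\<^sub>*, x\<^sub>n) - D(x\<^sub>*, x\<^sub>n\<^sub>+\<^sub>1) - D(x\<^sub>n\<^sub>+\<^sub>1, x\<^sub>n)\<close>, and the strong MVI condition bounds that pairing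
  below by \<open>\<mu> \<parallel>x\<^sub>n\<^sub>+\<^sub>1 - x\<^sub>*\<parallel>\<^sup>2\<close>. The term \<open>D(x\<^sub>n\<^sub>+\<^sub>1, x\<^sub>n)\<close> is nonnegative by
  convexity and can be dropped, and the descent lemma
  \<open>D(x\<^sub>*, y) \<le> L\<^sub>h/2 \<parallel>x\<^sub>* - y\<parallel>\<^sup>2\<close> converts the squared distance back into a Bregman distance. Hence
  \<open>(1 + 2\<mu>/L\<^sub>h) D(x\<^sub>*, x\<^sub>n\<^sub>+\<^sub>1) \<le> D(x\<^sub>*, x\<^sub>n)\<close>, which is iterated.

  These inequalities are applied along whole segments ending at \<open>x\<^sub>*\<close>, a point that could a priori
  lie outside the interior of the domain of \<open>h\<close>. It cannot: a Lipschitz gradient stays bounded near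
  every boundary point, whereas essential smoothness makes it blow up there. So the interior of the
  domain has no boundary points, and by connectedness \<open>h\<close> is finite and differentiable everywhere.
\<close>

section \<open>The domain and the gradient of a smooth Legendre function\<close>

text \<open>Boundedness of a Lipschitz gradient on a convergent sequence contradicts its blow-up at the
  boundary.\<close>

lemma essentially_smooth_Lipschitz_imp_interior_UNIV:
  fixes h :: "'a::real_inner \<Rightarrow> ereal"
  assumes es: "essentially_smooth h" and sm: "smooth_fun L h"
  shows "interior (edom h) = UNIV"
proof -
  let ?S = "interior (edom h)"
  have "frontier ?S = {}"
  proof (rule ccontr)
    assume "frontier ?S \<noteq> {}"
    then obtain p where p: "p \<in> frontier ?S" by blast
    then obtain X where X: "\<And>n. X n \<in> ?S" "X \<longlonglongrightarrow> p"
      unfolding frontier_def Diff_iff closure_sequential by blast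
    have "filterlim (\<lambda>k. norm (gradient h (X k))) at_top sequentially"
      using es p X unfolding essentially_smooth_def by blast
    moreover obtain B where B: "\<And>n. norm (X n) \<le> B"
      using convergent_imp_Bseq[OF convergentI[OF X(2)]] unfolding Bseq_def by blast
    have "norm (gradient h (X n)) \<le> norm (gradient h (X 0)) + L * (B + norm (X 0))" for n
    proof -
      have "norm (gradient h (X n) - gradient h (X 0)) \<le> L * norm (X n - X 0)"
        using sm X(1) unfolding smooth_fun_def lipschitz_on_def dist_norm by blast
      also have "\<dots> \<le> L * (B + norm (X 0))"
        using sm B[of n] norm_triangle_ineq4[of "X n" "X 0"]
        by (intro mult_left_mono) (auto simp: smooth_fun_def lipschitz_on_def)
      finally show ?thesis
        using norm_triangle_ineq2[of "gradient h (X n)" "gradient h (X 0)"] by linarith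
    qed
    ultimately show False
      unfolding filterlim_at_top_dense eventually_sequentially
      by (meson leD order_refl)
  qed
  then show ?thesis
    using es unfolding essentially_smooth_def frontier_eq_empty by blast
qed

text \<open>In finite dimension every linear functional is an inner product with a vector, here the adjoint
  of the derivative at \<open>1\<close>; hence differentiability already provides the gradient.\<close>

lemma differentiable_imp_GDERIV_gradient:
  fixes h :: "'a::euclidean_space \<Rightarrow> ereal"
  assumes "(\<lambda>y. real_of_ereal (h y)) differentiable (at x)"
  shows "GDERIV (\<lambda>y. real_of_ereal (h y)) x :> gradient h x"
proof -
  let ?f = "\<lambda>y. real_of_ereal (h y)"
  obtain f' where f': "(?f has_derivative f') (at x)"
    using assms unfolding differentiable_def by blast
  have "f' = (\<lambda>v. v \<bullet> adjoint f' 1)"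
    using adjoint_works[OF has_derivative_linear[OF f'], of _ 1] by (simp add: fun_eq_iff)
  then have g: "GDERIV ?f x :> adjoint f' 1"
    using f' unfolding gderiv_def
    by (rule subst[where P = "\<lambda>F. (?f has_derivative F) (at x)"])
  have "g' = adjoint f' 1" if "GDERIV ?f x :> g'" for g'
    using has_derivative_unique[OF that[unfolded gderiv_def] g[unfolded gderiv_def]]
    by (simp add: fun_eq_iff vector_eq_ldot)
  then have "gradient h x = adjoint f' 1"
    unfolding gradient_def by (intro the_equality g)
  then show ?thesis using g by simp
qed

lemma strictly_convex_fun_imp_convex_on:
  fixes h :: "'a::real_normed_vector \<Rightarrow> ereal"
  assumes sc: "strictly_convex_fun h" and fin: "\<And>y. h y = ereal (f y)"
  shows "convex_on UNIV f"
proof (rule convex_onI)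
  fix t :: real and x y :: 'a
  assume t: "0 < t" "t < 1"
  show "f ((1 - t) *\<^sub>R x + t *\<^sub>R y) \<le> (1 - t) * f x + t * f y"
  proof (cases "x = y")
    case True
    then show ?thesis by (simp add: algebra_simps flip: scaleR_add_left)
  next
    case False
    then have "h ((1 - t) *\<^sub>R x + t *\<^sub>R y) < ereal (1 - t) * h x + ereal t * h y"
      using sc t fin unfolding strictly_convex_fun_def edom_def by auto
    then show ?thesis by (simp add: fin)
  qed
qed simp

section \<open>First-order inequalities\<close>

text \<open>Both inequalities below follow by restricting the function to the segment from \<open>y\<close> to \<open>x\<close>.\<close>

lemma GDERIV_along_line:
  fixes f :: "'a::real_inner \<Rightarrow> real"
  assumes "\<And>z. GDERIV f z :> g z"
  shows "((\<lambda>t. f (y + t *\<^sub>R d)) has_real_derivative g (y + t *\<^sub>R d) \<bullet> d) (at t)"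
proof -
  have "((\<lambda>t. y + t *\<^sub>R d) has_derivative (\<lambda>s. s *\<^sub>R d)) (at t)"
    by (auto intro!: derivative_eq_intros)
  from has_derivative_compose[OF this assms[unfolded gderiv_def]]
  show ?thesis
    by (simp add: has_field_derivative_def inner_commute mult_commute_abs)
qed

lemma convex_on_above_tangent_plane:
  fixes f :: "'a::real_inner \<Rightarrow> real"
  assumes cv: "convex_on UNIV f" and g: "\<And>z. GDERIV f z :> g z"
  shows "f y + g y \<bullet> (x - y) \<le> f x"
proof -
  let ?p = "\<lambda>t. f (y + t *\<^sub>R (x - y))"
  have "convex_on UNIV ?p"
  proof (rule convex_onI)
    fix t a b :: real assume "0 < t" "t < 1"
    then have "f ((1 - t) *\<^sub>R (y + a *\<^sub>R (x - y)) + t *\<^sub>R (y + b *\<^sub>R (x - y)))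
        \<le> (1 - t) * ?p a + t * ?p b"
      by (intro convex_onD[OF cv]) auto
    then show "?p ((1 - t) *\<^sub>R a + t *\<^sub>R b) \<le> (1 - t) * ?p a + t * ?p b"
      by (simp add: algebra_simps)
  qed simp
  from convex_on_imp_above_tangent[OF this, of 0 1 "g y \<bullet> (x - y)"]
  show ?thesis using GDERIV_along_line[OF g, of y "x - y" 0] by simp
qed

text \<open>The descent lemma: on the segment, the gap between \<open>f\<close> and the quadratic upper model has the
  nonpositive derivative \<open>(\<nabla>f(y + t d) - \<nabla>f(y)) \<bullet> d - L t \<parallel>d\<parallel>\<^sup>2\<close>.\<close>

lemma Lipschitz_gradient_descent_lemma:
  fixes f :: "'a::real_inner \<Rightarrow> real"
  assumes g: "\<And>z. GDERIV f z :> g z" and lip: "L-lipschitz_on UNIV g"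
  shows "f x \<le> f y + g y \<bullet> (x - y) + L / 2 * (norm (x - y))\<^sup>2"
proof -
  define d where "d = x - y"
  define q where "q = (\<lambda>t. f (y + t *\<^sub>R d) - t * (g y \<bullet> d) - L / 2 * t\<^sup>2 * (norm d)\<^sup>2)"
  have "q 1 \<le> q 0"
  proof (rule DERIV_nonpos_imp_nonincreasing[where f = q])
    fix t :: real assume t: "0 \<le> t" "t \<le> 1"
    have "(q has_real_derivative g (y + t *\<^sub>R d) \<bullet> d - g y \<bullet> d - L * t * (norm d)\<^sup>2) (at t)"
      unfolding q_def by (auto intro!: derivative_eq_intros GDERIV_along_line[OF g])
    moreover have "g (y + t *\<^sub>R d) \<bullet> d - g y \<bullet> d \<le> L * t * (norm d)\<^sup>2"
    proof -
      have "(g (y + t *\<^sub>R d) - g y) \<bullet> d \<le> norm (g (y + t *\<^sub>R d) - g y) * norm d"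
        by (rule norm_cauchy_schwarz)
      also have "\<dots> \<le> (L * norm (t *\<^sub>R d)) * norm d"
        using lipschitz_onD[OF lip, of "y + t *\<^sub>R d" y]
        by (intro mult_right_mono) (auto simp: dist_norm)
      finally show ?thesis
        using t by (simp add: inner_diff_left power2_eq_square mult.assoc)
    qed
    ultimately show "\<exists>l. (q has_real_derivative l) (at t) \<and> l \<le> 0"
      by (intro exI conjI) auto
  qed simp
  then show ?thesis by (simp add: d_def q_def)
qed

section \<open>Contraction of the Bregman distance\<close>

text \<open>The one-step estimate, phrased for a single element \<open>g y - g z\<close> of the operator at \<open>z\<close>. For
  \<open>L = 0\<close> the quotient is \<open>0\<close> and the factor \<open>1\<close>, which matches mere monotonicity.\<close>

lemma bregman_proximal_step_contraction:
  fixes f :: "'a::real_inner \<Rightarrow> real"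
  assumes cv: "convex_on UNIV f" and g: "\<And>z. GDERIV f z :> g z"
    and lip: "L-lipschitz_on UNIV g" and mu: "\<mu> \<ge> 0"
    and mvi: "(z - xs) \<bullet> (g y - g z) \<ge> \<mu> * (norm (z - xs))\<^sup>2"
  defines "D \<equiv> \<lambda>a b. f a - f b - g b \<bullet> (a - b)"
  shows "(2 * \<mu> / L + 1) * D xs z \<le> D xs y"
proof -
  have L: "L \<ge> 0" using lip lipschitz_on_nonneg by blast
  have "2 * \<mu> / L * D xs z \<le> \<mu> * (norm (z - xs))\<^sup>2"
  proof (cases "L = 0")
    case True
    then show ?thesis using mu by simp
  next
    case False
    have "D xs z \<le> L / 2 * (norm (z - xs))\<^sup>2"
      using Lipschitz_gradient_descent_lemma[OF g lip, of xs z]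
      by (simp add: D_def norm_minus_commute)
    from mult_left_mono[OF this, of "2 * \<mu> / L"] show ?thesis
      using mu L False by (simp add: field_simps)
  qed
  also have "\<dots> \<le> (z - xs) \<bullet> (g y - g z)" by (rule mvi)
  also have "\<dots> = D xs y - D xs z - D z y"
    by (simp add: D_def inner_diff_left inner_diff_right inner_commute)
  also have "\<dots> \<le> D xs y - D xs z"
    using convex_on_above_tangent_plane[OF cv g, of y z] by (simp add: D_def)
  finally show ?thesis by (simp add: algebra_simps)
qed

lemma geometric_decay:
  fixes D :: "nat \<Rightarrow> real"
  assumes "c > 0" and "\<And>n. c * D (Suc n) \<le> D n"
  shows "D k \<le> c powi (- int k) * D 0"
proof -
  have "c ^ k * D k \<le> D 0"
  proof (induction k)
    case (Suc k)
    have "c ^ k * (c * D (Suc k)) \<le> c ^ k * D k"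
      using assms by (intro mult_left_mono) auto
    with Suc show ?case by (simp add: mult_ac)
  qed simp
  then show ?thesis
    using assms(1) by (simp add: power_int_minus field_simps)
qed

theorem theorem4p4:
  fixes M :: "real ^ 'd \<Rightarrow> (real ^ 'd) set"
    and h :: "real ^ 'd \<Rightarrow> ereal"
    and x :: "nat \<Rightarrow> real ^ 'd"
    and xs :: "real ^ 'd"
    and \<gamma> \<mu> \<mu>\<^sub>h L\<^sub>h :: real
    and k :: nat
  assumes "zeros M \<noteq> {}"
    and "\<gamma> \<ge> 0" and "maximal_weakly_monotone \<gamma> M"
    and "\<mu> \<ge> 0" and "strong_MVI \<mu> M"
    and "Legendre_fun h"
    and "strongly_convex_fun \<mu>\<^sub>h h" and "smooth_fun L\<^sub>h h" and "\<mu>\<^sub>h > \<gamma>"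
    and "x 0 \<in> interior (edom h)"
    and "\<And>n. x (Suc n) \<in> resolvent h M (x n)"
    and "k \<ge> 1"
    and "xs \<in> strong_MVI_solutions \<mu> M"
  shows "bregman h xs (x k) \<le> ereal ((2 * \<mu> / L\<^sub>h + 1) powi (- int k)) * bregman h xs (x 0)"
proof -
  let ?g = "gradient h"
  define f where "f = (\<lambda>y. real_of_ereal (h y))"
  define D where "D = (\<lambda>a b. f a - f b - ?g b \<bullet> (a - b))"
  note leg = \<open>Legendre_fun h\<close>[unfolded Legendre_fun_def]
  have int: "interior (edom h) = UNIV"
    using essentially_smooth_Lipschitz_imp_interior_UNIV \<open>smooth_fun L\<^sub>h h\<close> leg by blast
  have fin: "h y = ereal (f y)" for y
  proof -
    have "y \<in> edom h" using int interior_subset by blast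
    then show ?thesis
      using leg unfolding proper_fun_def edom_def f_def by (cases "h y") auto
  qed
  have cv: "convex_on UNIV f"
    using strictly_convex_fun_imp_convex_on[of h f] fin leg by blast
  have g: "GDERIV f z :> ?g z" for z
    unfolding f_def
    by (rule differentiable_imp_GDERIV_gradient) (use leg int in \<open>auto simp: essentially_smooth_def\<close>)
  have lip: "L\<^sub>h-lipschitz_on UNIV ?g"
    using \<open>smooth_fun L\<^sub>h h\<close> int unfolding smooth_fun_def by simp
  have "(2 * \<mu> / L\<^sub>h + 1) * D xs (x (Suc n)) \<le> D xs (x n)" for n
  proof -
    have "(x (Suc n) - xs) \<bullet> (?g (x n) - ?g (x (Suc n))) \<ge> \<mu> * (norm (x (Suc n) - xs))\<^sup>2"
      using assms(11)[of n] \<open>xs \<in> strong_MVI_solutions \<mu> M\<close>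
      unfolding resolvent_def strong_MVI_solutions_def gra_def by auto
    from bregman_proximal_step_contraction[OF cv g lip \<open>\<mu> \<ge> 0\<close> this]
    show ?thesis unfolding D_def .
  qed
  moreover have "2 * \<mu> / L\<^sub>h + 1 > 0"
    using \<open>\<mu> \<ge> 0\<close> lipschitz_on_nonneg[OF lip] by (simp add: add_nonneg_pos)
  ultimately have "D xs (x k) \<le> (2 * \<mu> / L\<^sub>h + 1) powi (- int k) * D xs (x 0)"
    by (intro geometric_decay)
  moreover have "bregman h xs y = ereal (D xs y)" for y
    by (simp add: bregman_def fin D_def)
  ultimately show ?thesis by simp
qed

end
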